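(* Let $U=\{u^j\}_{j=1}^N\subset X$ be a data set in a Hilbert space $X$, let $\{\lambda_i^{DQ1}\}$ and $\{\varphi_i\}$ be the POD eigenvalues and POD modes of the operator $K_1$ defined in the context, and let $s$ be the number of positive POD eigenvalues. Let $r$ be a positive integer, $X_r=\mathrm{span}\{\varphi_k\}_{k=1}^r$, and let $\Pi_r^X:X\to X$ be the orthogonal projection onto $X_r$. Set $C=2\max\{T,1\}$. Then $$\max_{1\le j\le N}\|u^j-\Pi_r^Xu^j\|_X^2\le C\left(\sum_{i=r+1}^s\lambda_i^{DQ1}\right).$$ If $Y$ is a Hilbert space with $U\subset Y$, then $$\max_{1\le j\le N}\|u^j-\Pi_r^Xu^j\|_Y^2\le C\left(\sum_{i=r+1}^s\lambda_i^{DQ1}\|\varphi_i\|_Y^2\right),$$ and if in addition $\pi_r:Y\to Y$ is a bounded linear projection onto $X_r$, then $$\max_{1\le j\le N}\|u^j-\pi_ru^j\|_Y^2\le C\left(\sum_{i=r+1}^s\lambda_i^{DQ1}\|\varphi_i-\pi_r\varphi_i\|_Y^2\right).$$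
   Context: $X$ and $Y$ are Hilbert spaces over $\mathbb{K}=\mathbb{R}$ or $\mathbb{C}$ (when both appear, they are linear subspaces of a common vector space, so that the linear operations on common elements agree). $N\ge2$ is an integer, $T>0$, $\Delta t=T/(N-1)$, and $\partial u^j=\frac{u^{j+1}-u^j}{\Delta t}$ for $j=1,\dots,N-1$. Let $S=\mathbb{K}^N$ with the weighted inner product $(g,h)_S=\sum_{j=1}^N\gamma_j g^j\overline{h^j}$, where $\gamma_1=1$ and $\gamma_{j}=\Delta t$ for $j=2,\dots,N$. The operator $K_1:S\to X$ is $$K_1 f=f^1u^1+\sum_{j=1}^{N-1}\Delta t\,f^{j+1}\,\partial u^j,\qquad f=[f^1,\dots,f^N]^T.$$ It has a singular value decomposition with singular values $(\lambda_i^{DQ1})^{1/2}$, in nonincreasing order, and orthonormal singular vectors $f_i\in S$, $\varphi_i\in X$, so that $K_1f_i=(\lambda_i^{DQ1})^{1/2}\varphi_i$. The $\varphi_i$ are the POD modes and the $\lambda_i^{DQ1}$ the POD eigenvalues; $r$ is such that the modes $\varphi_1,\dots,\varphi_r$ exist. A bounded linear operator $\Pi$ on a normed space is a projection onto a subspace $Z_r$ if $\Pi^2=\Pi$ and its range is $Z_r$ (it need not be orthogonal). Empty sums are zero. *)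

theory Defs
  imports Complex_Main "HOL-Library.Extended_Nat"
begin

text \<open>
  The scalar fields \<open>\<real>\<close> and \<open>\<complex>\<close>, treated uniformly.  By lemma \<open>rc_scalar_cases\<close> below, these are
  the only models of the class; the axioms force \<open>conj\<close> and \<open>re\<close> to be conjugation and real part.
\<close>

class rc_scalar = real_normed_field +
  fixes conj :: "'a \<Rightarrow> 'a" and re :: "'a \<Rightarrow> real"
  assumes conj_add: "conj (x + y) = conj x + conj y"
    and add_conj_scaleR: "x + conj x = scaleR (2 * re x) 1"
    and mult_conj_scaleR: "x * conj x = scaleR ((norm x)\<^sup>2) 1"

lemma add_conj: "x + conj x = of_real (2 * re x)" for x :: "'k::rc_scalar"
  unfolding of_real_def by (rule add_conj_scaleR)

lemma mult_conj: "x * conj x = of_real ((norm x)\<^sup>2)" for x :: "'k::rc_scalar"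
  unfolding of_real_def by (rule mult_conj_scaleR)

instantiation real :: rc_scalar
begin
definition "conj = (\<lambda>x::real. x)"
definition "re = (\<lambda>x::real. x)"
instance
  by standard (simp_all add: conj_real_def re_real_def power2_eq_square)
end

instantiation complex :: rc_scalar
begin
definition "conj = cnj"
definition "re = Re"
instance
  by standard (simp_all add: conj_complex_def re_complex_def complex_add_cnj
      complex_norm_square[symmetric] scaleR_conv_of_real del: of_real_power)
end

lemma rc_scalar_cases:
  "(\<forall>x::'k::rc_scalar. x \<in> \<real>) \<or>
   (\<exists>i::'k. i * i = - 1 \<and> (\<forall>x. \<exists>a b. x = of_real a + of_real b * i))"
proof (cases "\<forall>x::'k. x \<in> \<real>")
  case True
  then show ?thesis by blast
next
  case False
  have decomp: "x = of_real (re x) + (x - of_real (re x))" for x :: 'k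
    by simp
  have conj_im: "conj (x - of_real (re x)) = - (x - of_real (re x))" for x :: 'k
  proof -
    have c: "conj (- (of_real (re x) :: 'k)) = - of_real (re x)"
    proof (cases "re x = 0")
      case True
      then show ?thesis using conj_add[of "0::'k" 0] by simp
    next
      case nz: False
      have "- (of_real (re x) :: 'k) * conj (- of_real (re x)) = of_real ((re x)\<^sup>2)"
        using mult_conj[of "- (of_real (re x) :: 'k)"] by simp
      also have "\<dots> = - (of_real (re x) :: 'k) * (- of_real (re x))"
        by (simp add: power2_eq_square)
      finally show ?thesis using nz by (metis mult_cancel_left neg_equal_0_iff_equal of_real_eq_0_iff)
    qed
    have "conj (x + - of_real (re x)) = conj x - of_real (re x)"
      by (simp only: conj_add c) simp
    moreover have "conj x = of_real (2 * re x) - x"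
      using add_conj[of x] by (metis add_diff_cancel_left')
    ultimately show ?thesis by simp
  qed
  have sq: "y * y = - of_real ((norm y)\<^sup>2)" if "conj y = - y" for y :: 'k
    using mult_conj[of y] that by (metis add.inverse_inverse minus_mult_right)
  obtain x0 :: 'k where "x0 \<notin> \<real>" using False by blast
  define y where "y = x0 - of_real (re x0)"
  have y0: "y \<noteq> 0" using \<open>x0 \<notin> \<real>\<close> unfolding y_def by (metis Reals_of_real eq_iff_diff_eq_0)
  define i where "i = of_real (1 / norm y) * y"
  have ysq: "y * y = - of_real ((norm y)\<^sup>2)"
    using sq conj_im unfolding y_def by blast
  have "i * i = of_real (1 / norm y) * of_real (1 / norm y) * (y * y)"
    by (simp add: i_def)
  also have "\<dots> = - of_real (1 / norm y * (1 / norm y) * (norm y)\<^sup>2)"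
    unfolding ysq by simp
  also have "1 / norm y * (1 / norm y) * (norm y)\<^sup>2 = 1"
    using y0 by (simp add: power2_eq_square)
  finally have i2: "i * i = - 1" by simp
  have "\<exists>a b. x = of_real a + of_real b * i" for x :: 'k
  proof -
    define z where "z = x - of_real (re x)"
    define n where "n = norm z"
    have "z * z = - of_real (n\<^sup>2)" using sq conj_im unfolding z_def n_def by blast
    moreover have "(of_real n * i) * (of_real n * i) = of_real (n\<^sup>2) * (i * i)"
      by (simp add: power2_eq_square)
    ultimately have "z * z = (of_real n * i) * (of_real n * i)"
      using i2 by simp
    then have "z = of_real n * i \<or> z = - (of_real n * i)"
      by (simp add: square_eq_iff)
    then have "z = of_real n * i \<or> z = of_real (- n) * i" by simp
    then obtain b where "z = of_real b * i" by blast
    then show ?thesis using decomp[of x] unfolding z_def by metis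
  qed
  with i2 show ?thesis by blast
qed

definition ip_norm :: "('v \<Rightarrow> 'v \<Rightarrow> 'k::rc_scalar) \<Rightarrow> 'v \<Rightarrow> real" where
  "ip_norm ip x = sqrt (re (ip x x))"

text \<open>
  A Hilbert space whose underlying vector space is a linear subspace \<open>X\<close> of the ambient space \<open>'v\<close>.
  The values of \<open>ip\<close> outside \<open>X\<close> are unconstrained.
\<close>

locale hilbert_space = vector_space scale
  for scale :: "'k::rc_scalar \<Rightarrow> 'v::ab_group_add \<Rightarrow> 'v" +
  fixes X :: "'v set" and ip :: "'v \<Rightarrow> 'v \<Rightarrow> 'k"
  assumes subspace_carrier: "module.subspace scale X"
    and ip_add_left: "\<lbrakk>x \<in> X; y \<in> X; z \<in> X\<rbrakk> \<Longrightarrow> ip (x + y) z = ip x z + ip y z"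
    and ip_scale_left: "\<lbrakk>x \<in> X; y \<in> X\<rbrakk> \<Longrightarrow> ip (scale c x) y = c * ip x y"
    and ip_commute: "\<lbrakk>x \<in> X; y \<in> X\<rbrakk> \<Longrightarrow> ip y x = conj (ip x y)"
    and ip_pos: "\<lbrakk>x \<in> X; x \<noteq> 0\<rbrakk> \<Longrightarrow> 0 < re (ip x x)"
    and complete:
      "\<lbrakk>\<And>n. a n \<in> X; \<And>e. 0 < e \<Longrightarrow> \<exists>M. \<forall>m\<ge>M. \<forall>n\<ge>M. ip_norm ip (a m - a n) < e\<rbrakk>
        \<Longrightarrow> \<exists>l\<in>X. (\<lambda>n. ip_norm ip (a n - l)) \<longlonglongrightarrow> 0"

definition bounded_linear_on ::
  "('k::rc_scalar \<Rightarrow> 'v::ab_group_add \<Rightarrow> 'v) \<Rightarrow> 'v set \<Rightarrow> ('v \<Rightarrow> 'v \<Rightarrow> 'k) \<Rightarrow> ('v \<Rightarrow> 'v) \<Rightarrow> bool" where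
  "bounded_linear_on scale X ip P \<longleftrightarrow>
     (\<forall>x\<in>X. P x \<in> X) \<and>
     (\<forall>x\<in>X. \<forall>y\<in>X. P (x + y) = P x + P y) \<and>
     (\<forall>c. \<forall>x\<in>X. P (scale c x) = scale c (P x)) \<and>
     (\<exists>B. \<forall>x\<in>X. ip_norm ip (P x) \<le> B * ip_norm ip x)"

definition projection_onto ::
  "('k::rc_scalar \<Rightarrow> 'v::ab_group_add \<Rightarrow> 'v) \<Rightarrow> 'v set \<Rightarrow> ('v \<Rightarrow> 'v \<Rightarrow> 'k) \<Rightarrow> 'v set \<Rightarrow> ('v \<Rightarrow> 'v) \<Rightarrow> bool" where
  "projection_onto scale X ip Z P \<longleftrightarrow>
     bounded_linear_on scale X ip P \<and> (\<forall>x\<in>X. P (P x) = P x) \<and> P ` X = Z"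

definition orthogonal_projection_onto ::
  "('k::rc_scalar \<Rightarrow> 'v::ab_group_add \<Rightarrow> 'v) \<Rightarrow> 'v set \<Rightarrow> ('v \<Rightarrow> 'v \<Rightarrow> 'k) \<Rightarrow> 'v set \<Rightarrow> ('v \<Rightarrow> 'v) \<Rightarrow> bool" where
  "orthogonal_projection_onto scale X ip Z P \<longleftrightarrow>
     projection_onto scale X ip Z P \<and> (\<forall>x\<in>X. \<forall>z\<in>Z. ip (x - P x) z = 0)"

definition orthonormal_on :: "('a \<Rightarrow> 'a \<Rightarrow> 'k::rc_scalar) \<Rightarrow> nat set \<Rightarrow> (nat \<Rightarrow> 'a) \<Rightarrow> bool" where
  "orthonormal_on ip I e \<longleftrightarrow> (\<forall>i\<in>I. \<forall>j\<in>I. ip (e i) (e j) = (if i = j then 1 else 0))"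

text \<open>
  Elements of \<open>S = K^N\<close> are functions on \<open>nat\<close> of which only the components \<open>1, \<dots>, N\<close> matter.
\<close>

definition time_step :: "real \<Rightarrow> nat \<Rightarrow> real" where
  "time_step T N = T / (real N - 1)"

definition S_inner :: "real \<Rightarrow> nat \<Rightarrow> (nat \<Rightarrow> 'k::rc_scalar) \<Rightarrow> (nat \<Rightarrow> 'k) \<Rightarrow> 'k" where
  "S_inner T N g h =
     (\<Sum>j=1..N. of_real (if j = 1 then 1 else time_step T N) * g j * conj (h j))"

definition diff_quot ::
  "('k::rc_scalar \<Rightarrow> 'v::ab_group_add \<Rightarrow> 'v) \<Rightarrow> real \<Rightarrow> nat \<Rightarrow> (nat \<Rightarrow> 'v) \<Rightarrow> nat \<Rightarrow> 'v" where
  "diff_quot scale T N u j = scale (of_real (1 / time_step T N)) (u (j + 1) - u j)"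

definition K1 ::
  "('k::rc_scalar \<Rightarrow> 'v::ab_group_add \<Rightarrow> 'v) \<Rightarrow> real \<Rightarrow> nat \<Rightarrow> (nat \<Rightarrow> 'v) \<Rightarrow> (nat \<Rightarrow> 'k) \<Rightarrow> 'v" where
  "K1 scale T N u f =
     scale (f 1) (u 1) +
     (\<Sum>j=1..N-1. scale (of_real (time_step T N) * f (j + 1)) (diff_quot scale T N u j))"

text \<open>
  Singular value decomposition of an operator \<open>A\<close> from an \<open>N\<close>-dimensional inner product space, with
  inner product \<open>ipS\<close>, to the Hilbert space \<open>X\<close>.  The \<open>N\<close> right singular vectors \<open>f\<close> are an orthonormal
  basis, so \<open>A\<close> is determined by its values on them.  The left singular vectors are \<open>\<phi> i\<close> for
  \<open>1 \<le> i \<le> q\<close>: \<open>q\<close> may be smaller than \<open>N\<close> (then the remaining singular values vanish), and it may be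
  larger or infinite (then the further \<open>\<phi> i\<close> span directions orthogonal to the range of \<open>A\<close>).
\<close>

definition is_svd ::
  "('k::rc_scalar \<Rightarrow> 'v::ab_group_add \<Rightarrow> 'v) \<Rightarrow> nat \<Rightarrow> ('a \<Rightarrow> 'a \<Rightarrow> 'k) \<Rightarrow> 'v set \<Rightarrow> ('v \<Rightarrow> 'v \<Rightarrow> 'k)
    \<Rightarrow> ('a \<Rightarrow> 'v) \<Rightarrow> enat \<Rightarrow> (nat \<Rightarrow> real) \<Rightarrow> (nat \<Rightarrow> 'a) \<Rightarrow> (nat \<Rightarrow> 'v) \<Rightarrow> bool" where
  "is_svd scale N ipS X ip A q \<sigma> f \<phi> \<longleftrightarrow>
     (\<forall>i\<in>{1..N}. 0 \<le> \<sigma> i) \<and>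
     (\<forall>i\<in>{1..N}. \<forall>j\<in>{1..N}. i \<le> j \<longrightarrow> \<sigma> j \<le> \<sigma> i) \<and>
     orthonormal_on ipS {1..N} f \<and>
     (\<forall>i. 1 \<le> i \<and> enat i \<le> q \<longrightarrow> \<phi> i \<in> X) \<and>
     orthonormal_on ip {i. 1 \<le> i \<and> enat i \<le> q} \<phi> \<and>
     (\<forall>i\<in>{1..N}. enat i \<le> q \<longrightarrow> A (f i) = scale (of_real (\<sigma> i)) (\<phi> i)) \<and>
     (\<forall>i\<in>{1..N}. \<not> enat i \<le> q \<longrightarrow> \<sigma> i = 0 \<and> A (f i) = 0)"

definition is_pod_DQ1 ::
  "('k::rc_scalar \<Rightarrow> 'v::ab_group_add \<Rightarrow> 'v) \<Rightarrow> real \<Rightarrow> nat \<Rightarrow> 'v set \<Rightarrow> ('v \<Rightarrow> 'v \<Rightarrow> 'k) \<Rightarrow> (nat \<Rightarrow> 'v)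
    \<Rightarrow> enat \<Rightarrow> (nat \<Rightarrow> real) \<Rightarrow> (nat \<Rightarrow> nat \<Rightarrow> 'k) \<Rightarrow> (nat \<Rightarrow> 'v) \<Rightarrow> bool" where
  "is_pod_DQ1 scale T N X ip u q lam f \<phi> \<longleftrightarrow>
     (\<forall>i\<in>{1..N}. 0 \<le> lam i) \<and>
     is_svd scale N (S_inner T N) X ip (K1 scale T N u) q (\<lambda>i. sqrt (lam i)) f \<phi>"

end

theory Submission
  imports Defs "Jordan_Normal_Form.Determinant"
begin

text \<open>
  Let \<open>P\<close> be either projection and let \<open>e\<^sup>j = u\<^sup>j - P u\<^sup>j\<close> be the projection error of the data.  Its
  initial value and difference quotients, \<open>d\<^sub>1 = e\<^sup>1\<close> and \<open>d\<^sub>l = \<partial>e\<^sup>l\<^sup>-\<^sup>1\<close> for \<open>l \<ge> 2\<close>, are the natural unknowns: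
  with the weights \<open>\<gamma>\<^sub>l\<close> of \<open>S\<close>, the operator \<open>K\<^sub>1\<close> built from \<open>e\<close> sends \<open>g\<close> to \<open>\<Sum>\<^sub>l \<gamma>\<^sub>l g\<^sup>l d\<^sub>l\<close>, and the
  errors are recovered by \<open>e\<^sup>j = \<Sum>\<^sub>l\<^sub>\<le>\<^sub>j \<gamma>\<^sub>l d\<^sub>l\<close>.

  Two observations give the bound.  First, convexity of the squared norm yields
  \<open>\<bar>e\<^sup>j\<bar>\<^sup>2 \<le> (\<Sum>\<^sub>l \<gamma>\<^sub>l) (\<Sum>\<^sub>l \<gamma>\<^sub>l \<bar>d\<^sub>l\<bar>\<^sup>2)\<close>, where the weights add up to \<open>1 + T \<le> 2 max {T, 1}\<close>; this is the
  discrete counterpart of bounding a function pointwise by its initial value and its derivative.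
  Second, the sum \<open>\<Sum>\<^sub>l \<gamma>\<^sub>l \<bar>d\<^sub>l\<bar>\<^sup>2\<close> is the squared Hilbert-Schmidt norm of the operator built from \<open>e\<close>, so
  it can be evaluated in any orthonormal basis of \<open>S\<close>, in particular in the right singular vectors
  \<open>f\<^sub>i\<close>.  There it is explicit: since \<open>P\<close> is linear, the operator built from \<open>e\<close> sends \<open>f\<^sub>i\<close> to
  \<open>\<lambda>\<^sub>i\<^sup>1\<^sup>/\<^sup>2 (\<phi>\<^sub>i - P \<phi>\<^sub>i)\<close>, which vanishes for \<open>i \<le> r\<close> as \<open>P\<close> fixes \<open>X\<^sub>r\<close>, and for \<open>i > s\<close>.

  Lemma \<open>pointwise_norm_sq_le\<close> combines the two observations, and \<open>pod_projection_error\<close> inserts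
  the singular value decomposition.  The latter lets the norm, the carrier of the norm and the space
  on which \<open>P\<close> acts vary independently, so that one lemma serves all three estimates; for the
  orthogonal projection \<open>P \<phi>\<^sub>i = 0\<close> when \<open>i > r\<close>.

  The modes that matter lie in every space containing the data, because \<open>\<phi>\<^sub>i\<close> is a multiple
  of \<open>K\<^sub>1 f\<^sub>i\<close> when \<open>\<lambda>\<^sub>i > 0\<close>.  The modes with \<open>s < i \<le> r\<close> may lie outside \<open>Y\<close>.  For this reason the
  argument never asks for \<open>P u\<^sup>j \<in> Y\<close>: that the errors lie in \<open>Y\<close> is deduced from the images of
  the \<open>f\<^sub>i\<close>, from which the \<open>d\<^sub>l\<close> are recovered as linear combinations.
\<close>

section \<open>Conjugation and real part\<close>

lemma conj_zero [simp]: "conj (0::'k::rc_scalar) = 0"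
  using conj_add[of "0::'k" 0] by simp

lemma conj_of_real [simp]: "conj (of_real a :: 'k::rc_scalar) = of_real a"
proof (cases "a = 0")
  case False
  have "(of_real a :: 'k) * conj (of_real a) = of_real a * of_real a"
    by (simp add: mult_conj power2_eq_square)
  with False show ?thesis by simp
qed simp

lemma conj_conj [simp]: "conj (conj x) = (x::'k::rc_scalar)"
proof -
  have "conj x + conj (conj x) = conj (x + conj x)"
    by (simp add: conj_add)
  also have "\<dots> = conj x + x"
    by (simp only: add_conj conj_of_real) (simp only: add_conj[symmetric] add.commute)
  finally show ?thesis by simp
qed

text \<open>Multiplicativity comes from that of the norm, through \<open>x * conj x = \<bar>x\<bar>\<^sup>2\<close>.\<close>

lemma conj_mult: "conj (x * y) = conj x * conj (y::'k::rc_scalar)"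
proof (cases "x = 0 \<or> y = 0")
  case False
  have "(x * y) * conj (x * y) = of_real ((norm x)\<^sup>2) * of_real ((norm y)\<^sup>2)"
    by (simp only: mult_conj norm_mult power_mult_distrib of_real_mult)
  also have "\<dots> = (x * y) * (conj x * conj y)"
    by (simp only: mult_conj[symmetric] mult_ac)
  finally show ?thesis using False by simp
qed auto

lemma re_eqI: "x + conj x = of_real (2 * a) \<Longrightarrow> re (x::'k::rc_scalar) = a"
  by (metis add_conj mult_cancel_left of_real_eq_iff zero_neq_numeral)

lemma re_add: "re (x + y) = re x + re (y::'k::rc_scalar)"
proof (rule re_eqI)
  have "x + y + conj (x + y) = (x + conj x) + (y + conj y)"
    by (simp add: conj_add)
  also have "\<dots> = of_real (2 * (re x + re y))"
    by (simp only: add_conj of_real_add[symmetric] distrib_left)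
  finally show "x + y + conj (x + y) = of_real (2 * (re x + re y))" .
qed

lemma re_zero [simp]: "re (0::'k::rc_scalar) = 0"
  by (rule re_eqI) simp

lemma re_sum: "re (sum g A) = (\<Sum>i\<in>A. re (g i :: 'k::rc_scalar))"
  by (induction A rule: infinite_finite_induct) (simp_all add: re_add)

lemma re_of_real_mult: "re (of_real a * x) = a * re (x::'k::rc_scalar)"
proof (rule re_eqI)
  have "of_real a * x + conj (of_real a * x) = of_real a * (x + conj x)"
    by (simp add: conj_mult distrib_left)
  then show "of_real a * x + conj (of_real a * x) = of_real (2 * (a * re x))"
    by (simp add: add_conj mult_ac)
qed

lemma re_of_real [simp]: "re (of_real a :: 'k::rc_scalar) = a"
  by (rule re_eqI) simp

lemma re_conj [simp]: "re (conj x) = re (x::'k::rc_scalar)"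
  by (rule re_eqI) (simp add: add.commute add_conj)

section \<open>Inner products of finite sums\<close>

lemma orthonormal_onD:
  "orthonormal_on ip I e \<Longrightarrow> i \<in> I \<Longrightarrow> j \<in> I \<Longrightarrow> ip (e i) (e j) = (if i = j then 1 else 0)"
  by (auto simp: orthonormal_on_def)

text \<open>
  A vector space over the same scalars as \<open>hilbert_space\<close>: the algebra of \<open>K1\<close> can be stated in it
  independently of any inner product.
\<close>

locale rc_vector_space = vector_space scale
  for scale :: "'k::rc_scalar \<Rightarrow> 'v::ab_group_add \<Rightarrow> 'v"

sublocale hilbert_space \<subseteq> rc_vector_space ..

context hilbert_space
begin

lemma carrier_sum_scale: "(\<And>i. i \<in> A \<Longrightarrow> x i \<in> X) \<Longrightarrow> (\<Sum>i\<in>A. scale (c i) (x i)) \<in> X"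
  by (intro subspace_sum subspace_scale subspace_carrier)

lemma ip_add_right:
  assumes "x \<in> X" "y \<in> X" "z \<in> X"
  shows "ip x (y + z) = ip x y + ip x z"
proof -
  have "ip x (y + z) = conj (ip (y + z) x)"
    using assms subspace_add[OF subspace_carrier] by (intro ip_commute) auto
  also have "\<dots> = ip x y + ip x z"
    using assms by (simp add: ip_add_left conj_add ip_commute[symmetric])
  finally show ?thesis .
qed

lemma ip_scale_right:
  assumes "x \<in> X" "y \<in> X"
  shows "ip x (scale c y) = conj c * ip x y"
proof -
  have "ip x (scale c y) = conj (ip (scale c y) x)"
    using assms subspace_scale[OF subspace_carrier] by (intro ip_commute) auto
  also have "\<dots> = conj c * ip x y"
    using assms by (simp add: ip_scale_left conj_mult ip_commute[symmetric])
  finally show ?thesis .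
qed

lemma ip_zero_left: "x \<in> X \<Longrightarrow> ip 0 x = 0"
  using ip_scale_left[of x x 0] by simp

lemma ip_zero_right: "x \<in> X \<Longrightarrow> ip x 0 = 0"
  using ip_scale_right[of x x 0] by simp

lemma ip_sum_left:
  assumes "\<And>i. i \<in> A \<Longrightarrow> x i \<in> X" "y \<in> X"
  shows "ip (\<Sum>i\<in>A. scale (c i) (x i)) y = (\<Sum>i\<in>A. c i * ip (x i) y)"
  using assms(1)
proof (induction A rule: infinite_finite_induct)
  case (insert i A)
  then show ?case
    using assms(2) carrier_sum_scale[of A x c] subspace_scale[OF subspace_carrier]
    by (simp add: ip_add_left ip_scale_left)
qed (use assms(2) ip_zero_left in simp_all)

lemma ip_sum_right:
  assumes "\<And>i. i \<in> A \<Longrightarrow> x i \<in> X" "y \<in> X"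
  shows "ip y (\<Sum>i\<in>A. scale (c i) (x i)) = (\<Sum>i\<in>A. conj (c i) * ip y (x i))"
  using assms(1)
proof (induction A rule: infinite_finite_induct)
  case (insert i A)
  then show ?case
    using assms(2) carrier_sum_scale[of A x c] subspace_scale[OF subspace_carrier]
    by (simp add: ip_add_right ip_scale_right)
qed (use assms(2) ip_zero_right in simp_all)

lemma ip_norm_sq:
  assumes "x \<in> X"
  shows "(ip_norm ip x)\<^sup>2 = re (ip x x)"
proof (cases "x = 0")
  case True
  then show ?thesis using ip_zero_left[of 0] assms by (simp add: ip_norm_def)
next
  case False
  then show ?thesis using ip_pos[OF assms] by (simp add: ip_norm_def)
qed

lemma ip_norm_zero [simp]: "ip_norm ip 0 = 0"
  using ip_zero_left[of 0] subspace_0[OF subspace_carrier] by (simp add: ip_norm_def)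

lemma ip_self: 
  assumes "x \<in> X"
  shows "ip x x = of_real ((ip_norm ip x)\<^sup>2)"
proof -
  have "ip x x + ip x x = of_real (2 * re (ip x x))"
    using ip_commute[of x x] assms by (metis add_conj)
  then have "2 * ip x x = 2 * of_real (re (ip x x))"
    by (simp only: mult_2 of_real_add)
  then show ?thesis using assms by (simp add: ip_norm_sq)
qed

lemma ip_norm_scale_sq:
  assumes "x \<in> X"
  shows "(ip_norm ip (scale c x))\<^sup>2 = (norm c)\<^sup>2 * (ip_norm ip x)\<^sup>2"
proof -
  have "ip (scale c x) (scale c x) = (c * conj c) * ip x x"
    using assms subspace_scale[OF subspace_carrier]
    by (simp add: ip_scale_left ip_scale_right)
  also have "\<dots> = of_real ((norm c)\<^sup>2 * (ip_norm ip x)\<^sup>2)"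
    using assms by (simp only: mult_conj ip_self of_real_mult)
  finally show ?thesis
    using assms subspace_scale[OF subspace_carrier] by (simp add: ip_norm_sq del: of_real_mult)
qed

text \<open>This is \<open>0 \<le> \<bar>x - y\<bar>\<^sup>2\<close> expanded; the cross terms of a weighted sum are controlled by it.\<close>

lemma two_re_ip_le:
  assumes "x \<in> X" "y \<in> X"
  shows "2 * re (ip x y) \<le> (ip_norm ip x)\<^sup>2 + (ip_norm ip y)\<^sup>2"
proof -
  let ?y = "scale (of_real (- 1)) y"
  have y: "?y \<in> X" using assms subspace_scale[OF subspace_carrier] by blast
  have xy: "x + ?y \<in> X" using assms y subspace_add[OF subspace_carrier] by blast
  have "ip (x + ?y) (x + ?y)
      = ip x x + of_real (- 1) * ip x y + (of_real (- 1) * conj (ip x y) + ip y y)"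
    using assms y xy ip_commute[of x y]
    by (simp add: ip_add_left ip_add_right ip_scale_left ip_scale_right
        del: of_real_minus scale_minus_left) simp
  then have "re (ip (x + ?y) (x + ?y)) = re (ip x x) - 2 * re (ip x y) + re (ip y y)"
    by (simp only: re_add re_of_real_mult re_conj)
  moreover have "0 \<le> re (ip (x + ?y) (x + ?y))"
    using xy by (metis ip_norm_sq zero_le_power2)
  ultimately show ?thesis using assms by (simp add: ip_norm_sq)
qed

text \<open>
  Jensen's inequality for the squared norm, multiplied through by the total weight, obtained by
  bounding each cross term \<open>ip (d l) (d k)\<close> by the mean of the two squares.
\<close>

lemma weighted_sum_norm_sq_le:
  assumes "\<And>l. l \<in> L \<Longrightarrow> 0 \<le> g l" "\<And>l. l \<in> L \<Longrightarrow> d l \<in> X"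
  shows "(ip_norm ip (\<Sum>l\<in>L. scale (of_real (g l)) (d l)))\<^sup>2
    \<le> sum g L * (\<Sum>l\<in>L. g l * (ip_norm ip (d l))\<^sup>2)"
proof -
  let ?n = "\<lambda>l. (ip_norm ip (d l))\<^sup>2"
  let ?v = "\<Sum>l\<in>L. scale (of_real (g l)) (d l)"
  have v: "?v \<in> X" using assms(2) by (rule carrier_sum_scale)
  have "ip ?v ?v = (\<Sum>k\<in>L. of_real (g k) * (\<Sum>l\<in>L. of_real (g l) * ip (d l) (d k)))"
    using assms(2) v by (simp add: ip_sum_left ip_sum_right)
  then have "(ip_norm ip ?v)\<^sup>2 = (\<Sum>k\<in>L. g k * (\<Sum>l\<in>L. g l * re (ip (d l) (d k))))"
    using v by (simp add: ip_norm_sq re_sum re_of_real_mult)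
  also have "\<dots> \<le> (\<Sum>k\<in>L. g k * (\<Sum>l\<in>L. g l * ((?n k + ?n l) / 2)))"
  proof -
    have "re (ip (d l) (d k)) \<le> (?n k + ?n l) / 2" if "k \<in> L" "l \<in> L" for k l
      using two_re_ip_le[of "d l" "d k"] assms(2) that by simp
    then show ?thesis using assms(1) by (intro sum_mono mult_left_mono) auto
  qed
  also have "\<dots> = (\<Sum>k\<in>L. \<Sum>l\<in>L. (g k * ?n k) * g l / 2 + g k * (g l * ?n l) / 2)"
    by (simp add: sum_distrib_left distrib_left distrib_right add_divide_distrib mult_ac)
  also have "\<dots> = sum g L * (\<Sum>l\<in>L. g l * ?n l)"
    by (simp only: sum.distrib sum_divide_distrib[symmetric] sum_product[symmetric]) simp
  finally show ?thesis .
qed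

text \<open>
  The rows of \<open>c\<close> are orthonormal for the weights \<open>g\<close>, so expanding the squares and summing over
  \<open>l\<close> first kills all off-diagonal terms.  With \<open>c\<close> the change of basis matrix this says that
  the squared Hilbert-Schmidt norm has the same value in both bases.
\<close>

lemma sum_norm_sq_isometry:
  assumes "finite I"
    and c: "\<And>i k. i \<in> I \<Longrightarrow> k \<in> I \<Longrightarrow>
      (\<Sum>l\<in>L. of_real (g l) * c i l * conj (c k l)) = (if i = k then 1 else 0)"
    and w: "\<And>i. i \<in> I \<Longrightarrow> w i \<in> X"
  shows "(\<Sum>l\<in>L. g l * (ip_norm ip (\<Sum>i\<in>I. scale (c i l) (w i)))\<^sup>2)
    = (\<Sum>i\<in>I. (ip_norm ip (w i))\<^sup>2)"
proof -
  let ?v = "\<lambda>l. \<Sum>i\<in>I. scale (c i l) (w i)"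
  have v: "?v l \<in> X" for l using w by (rule carrier_sum_scale)
  have "(\<Sum>l\<in>L. of_real (g l) * ip (?v l) (?v l))
      = (\<Sum>l\<in>L. \<Sum>k\<in>I. \<Sum>i\<in>I. of_real (g l) * c i l * conj (c k l) * ip (w i) (w k))"
    using w v by (simp add: ip_sum_left ip_sum_right sum_distrib_left mult_ac)
  also have "\<dots> = (\<Sum>k\<in>I. \<Sum>i\<in>I. (\<Sum>l\<in>L. of_real (g l) * c i l * conj (c k l)) * ip (w i) (w k))"
    by (subst sum.swap, intro sum.cong refl, subst sum.swap) (simp add: sum_distrib_right)
  also have "\<dots> = (\<Sum>k\<in>I. \<Sum>i\<in>I. if i = k then ip (w i) (w k) else 0)"
    by (intro sum.cong refl) (simp add: c)
  also have "\<dots> = (\<Sum>i\<in>I. ip (w i) (w i))"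
    using assms(1) by simp
  finally have "(of_real (\<Sum>l\<in>L. g l * (ip_norm ip (?v l))\<^sup>2) :: 'k)
      = of_real (\<Sum>i\<in>I. (ip_norm ip (w i))\<^sup>2)"
    using w v by (simp add: ip_self)
  then show ?thesis by (simp only: of_real_eq_iff)
qed

end

section \<open>The weighted coordinate space\<close>

definition weight :: "real \<Rightarrow> nat \<Rightarrow> nat \<Rightarrow> real" where
  "weight T N l = (if l = 1 then 1 else time_step T N)"

lemma time_step_pos: "2 \<le> N \<Longrightarrow> 0 < T \<Longrightarrow> 0 < time_step T N"
  by (simp add: time_step_def)

lemma weight_pos: "2 \<le> N \<Longrightarrow> 0 < T \<Longrightarrow> 0 < weight T N l"
  by (simp add: weight_def time_step_pos)

text \<open>The \<open>N - 1\<close> time steps cover \<open>[0, T]\<close>.\<close>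

lemma sum_weight:
  assumes "2 \<le> N"
  shows "(\<Sum>l=1..N. weight T N l) = 1 + T"
proof -
  have "(\<Sum>l=1..N. weight T N l) = weight T N 1 + (\<Sum>l=2..N. weight T N l)"
    using assms by (simp add: sum.atLeast_Suc_atMost numeral_2_eq_2)
  also have "(\<Sum>l=2..N. weight T N l) = (\<Sum>l=2..N. time_step T N)"
    by (intro sum.cong) (auto simp: weight_def)
  also have "\<dots> = T"
    using assms by (simp add: time_step_def of_nat_diff)
  finally show ?thesis by (simp add: weight_def)
qed

lemma S_inner_weight:
  "S_inner T N g h = (\<Sum>j=1..N. of_real (weight T N j) * g j * conj (h j))"
  by (simp add: S_inner_def weight_def)

text \<open>
  The completeness relation dual to orthonormality.  In matrix form orthonormality is
  \<open>F D F\<^sup>* = 1\<close> with \<open>D\<close> the diagonal matrix of weights; as \<open>F\<close> is square, the right inverse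
  \<open>D F\<^sup>*\<close> is also a left inverse.
\<close>

lemma orthonormal_basis_complete:
  fixes f :: "nat \<Rightarrow> nat \<Rightarrow> 'k::rc_scalar"
  assumes f: "orthonormal_on (S_inner T N) {1..N} f"
    and "j \<in> {1..N}" "l \<in> {1..N}"
  shows "of_real (weight T N l) * (\<Sum>i=1..N. conj (f i l) * f i j) = (if j = l then 1 else 0)"
proof -
  let ?F = "mat N N (\<lambda>(i, j). f (Suc i) (Suc j))"
  let ?G = "mat N N (\<lambda>(j, k). of_real (weight T N (Suc j)) * conj (f (Suc k) (Suc j)))"
  have shift: "(\<Sum>i=0..<N. h (Suc i)) = (\<Sum>i=1..N. h i)" for h :: "nat \<Rightarrow> 'k"
    using sum.shift_bounds_Suc_ivl[of h 0 N] by (simp add: atLeastLessThanSuc_atLeastAtMost)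
  have "?F * ?G = 1\<^sub>m N"
  proof (rule eq_matI)
    fix i k assume "i < dim_row (1\<^sub>m N :: 'k mat)" "k < dim_col (1\<^sub>m N :: 'k mat)"
    then have ik: "i < N" "k < N" by simp_all
    have "(?F * ?G) $$ (i, k)
        = (\<Sum>j=0..<N. of_real (weight T N (Suc j)) * f (Suc i) (Suc j) * conj (f (Suc k) (Suc j)))"
      using ik by (simp add: scalar_prod_def mult_ac)
    also have "\<dots> = S_inner T N (f (Suc i)) (f (Suc k))"
      unfolding S_inner_weight by (rule shift)
    also have "\<dots> = (1\<^sub>m N) $$ (i, k)"
      using ik orthonormal_onD[OF f, of "Suc i" "Suc k"] by auto
    finally show "(?F * ?G) $$ (i, k) = (1\<^sub>m N) $$ (i, k)" .
  qed simp_all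
  then have GF: "?G * ?F = 1\<^sub>m N"
    by (rule mat_mult_left_right_inverse[rotated 2]) simp_all
  obtain l' j' where l: "l = Suc l'" "l' < N" and j: "j = Suc j'" "j' < N"
    using assms(2,3) by (cases l; cases j) auto
  have "(if j = l then 1 else 0) = (?G * ?F) $$ (l', j')"
    unfolding GF using l j by auto
  also have "\<dots> = (\<Sum>i=0..<N. of_real (weight T N l) * conj (f (Suc i) l) * f (Suc i) j)"
    using l j by (simp add: scalar_prod_def)
  also have "\<dots> = (\<Sum>i=1..N. of_real (weight T N l) * conj (f i l) * f i j)"
    by (rule shift)
  also have "\<dots> = of_real (weight T N l) * (\<Sum>i=1..N. conj (f i l) * f i j)"
    by (simp only: sum_distrib_left mult.assoc)
  finally show ?thesis by simp
qed

section \<open>Increments and the operator K1\<close>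

text \<open>
  The initial value followed by the difference quotients, with the index shifted by one so
  that the \<open>l\<close>-th entry is the one carrying the \<open>l\<close>-th weight of \<open>S\<close>.
\<close>

definition increment ::
  "('k::rc_scalar \<Rightarrow> 'v::ab_group_add \<Rightarrow> 'v) \<Rightarrow> real \<Rightarrow> nat \<Rightarrow> (nat \<Rightarrow> 'v) \<Rightarrow> nat \<Rightarrow> 'v" where
  "increment scale T N e l = (if l = 1 then e 1 else diff_quot scale T N e (l - 1))"

lemma K1_increment:
  assumes "2 \<le> N"
  shows "K1 scale T N e g
    = (\<Sum>l=1..N. scale (of_real (weight T N l) * g l) (increment scale T N e l))"
proof -
  let ?h = "\<lambda>l. scale (of_real (weight T N l) * g l) (increment scale T N e l)"
  have "Suc (N - 1) = N" using assms by simp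
  then have "(\<Sum>l=1..N. ?h l) = ?h 1 + (\<Sum>l=Suc 1..Suc (N-1). ?h l)"
    using assms sum.atLeast_Suc_atMost[of 1 N ?h] by (simp only:)
  also have "(\<Sum>l=Suc 1..Suc (N-1). ?h l) = (\<Sum>l=1..N-1. ?h (Suc l))"
    by (rule sum.shift_bounds_cl_Suc_ivl)
  also have "\<dots> = (\<Sum>l=1..N-1. scale (of_real (time_step T N) * g (l + 1)) (diff_quot scale T N e l))"
    by (intro sum.cong refl) (simp add: increment_def weight_def)
  also have "?h 1 = scale (g 1) (e 1)"
    by (simp add: increment_def weight_def)
  finally show ?thesis
    by (simp only: K1_def)
qed

lemma (in rc_vector_space) telescope_increment:
  assumes "2 \<le> N" "0 < T" "1 \<le> j"
  shows "e j = (\<Sum>l=1..j. scale (of_real (weight T N l)) (increment scale T N e l))"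
  using assms(3)
proof (induction j rule: dec_induct)
  case base
  then show ?case by (simp add: weight_def increment_def)
next
  case (step j)
  let ?inc = "scale (of_real (weight T N (Suc j))) (increment scale T N e (Suc j))"
  have "(of_real (time_step T N) * of_real (1 / time_step T N) :: 'k) = 1"
    using time_step_pos[OF assms(1,2)] by (simp flip: of_real_mult)
  then have "?inc = e (Suc j) - e j"
    using step.hyps by (simp add: weight_def increment_def diff_quot_def)
  then have "e (Suc j) = e j + ?inc" by simp
  also have "e j = (\<Sum>l=1..j. scale (of_real (weight T N l)) (increment scale T N e l))"
    by (rule step.IH)
  also have "\<dots> + ?inc = (\<Sum>l=1..Suc j. scale (of_real (weight T N l)) (increment scale T N e l))"
    by simp
  finally show ?case .
qed

text \<open>
  Inverting \<open>K1\<close> on a basis: its values at the \<open>f i\<close> determine the increments.  This also shows that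
  the increments lie in any subspace containing those values.
\<close>

lemma (in rc_vector_space) increment_expansion:
  assumes "2 \<le> N" "0 < T" "orthonormal_on (S_inner T N) {1..N} f" "l \<in> {1..N}"
  shows "increment scale T N e l = (\<Sum>i=1..N. scale (conj (f i l)) (K1 scale T N e (f i)))"
proof -
  let ?d = "increment scale T N e"
  let ?w = "\<lambda>j. of_real (weight T N j) :: 'k"
  have "(\<Sum>i=1..N. scale (conj (f i l)) (K1 scale T N e (f i)))
      = (\<Sum>j=1..N. \<Sum>i=1..N. scale (conj (f i l) * (?w j * f i j)) (?d j))"
    by (simp add: K1_increment[OF assms(1)] scale_sum_right) (rule sum.swap)
  also have "\<dots> = (\<Sum>j=1..N. scale (?w j * (\<Sum>i=1..N. conj (f i l) * f i j)) (?d j))"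
    by (intro sum.cong refl) (simp add: sum_distrib_left mult_ac flip: scale_sum_left)
  also have "\<dots> = (\<Sum>j=1..N. if j = l then ?d j else 0)"
  proof (intro sum.cong refl)
    fix j assume j: "j \<in> {1..N}"
    show "scale (?w j * (\<Sum>i=1..N. conj (f i l) * f i j)) (?d j) = (if j = l then ?d j else 0)"
      using orthonormal_basis_complete[OF assms(3) j assms(4)] weight_pos[OF assms(1,2), of l]
      by (auto split: if_splits)
  qed
  also have "\<dots> = ?d l"
    using assms(4) by simp
  finally show ?thesis by (rule sym)
qed

text \<open>
  The discrete pointwise bound for an arbitrary trajectory \<open>e\<close>.  Membership in \<open>X\<close> is required only of
  the images of the basis, since that is what is known about projection errors.
\<close>

lemma (in hilbert_space) pointwise_norm_sq_le:
  assumes N: "2 \<le> N" and T: "0 < T"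
    and f: "orthonormal_on (S_inner T N) {1..N} f"
    and K: "\<And>i. i \<in> {1..N} \<Longrightarrow> K1 scale T N e (f i) \<in> X"
    and j: "j \<in> {1..N}"
  shows "(ip_norm ip (e j))\<^sup>2
    \<le> 2 * max T 1 * (\<Sum>i=1..N. (ip_norm ip (K1 scale T N e (f i)))\<^sup>2)"
proof -
  let ?d = "increment scale T N e" and ?g = "weight T N"
  let ?n = "\<lambda>l. ?g l * (ip_norm ip (?d l))\<^sup>2"
  have g: "0 \<le> ?g l" for l using weight_pos[OF N T, of l] by simp
  have d: "?d l \<in> X" if "l \<in> {1..N}" for l
    unfolding increment_expansion[OF N T f that, of e] using K by (rule carrier_sum_scale)
  have sum_n: "(\<Sum>l=1..N. ?n l) = (\<Sum>i=1..N. (ip_norm ip (K1 scale T N e (f i)))\<^sup>2)"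
  proof -
    have "(\<Sum>l=1..N. ?n l) = (\<Sum>l=1..N. ?g l *
        (ip_norm ip (\<Sum>i=1..N. scale (conj (f i l)) (K1 scale T N e (f i))))\<^sup>2)"
      using increment_expansion[OF N T f, of _ e] by (intro sum.cong) auto
    also have "\<dots> = (\<Sum>i=1..N. (ip_norm ip (K1 scale T N e (f i)))\<^sup>2)"
    proof (rule sum_norm_sq_isometry)
      fix i k assume "i \<in> {1..N}" "k \<in> {1..N}"
      \<comment> \<open>The left-hand side is the inner product of \<open>f k\<close> and \<open>f i\<close>, in this order.\<close>
      then show "(\<Sum>l=1..N. of_real (?g l) * conj (f i l) * conj (conj (f k l)))
          = (if i = k then 1 else 0)"
        using orthonormal_onD[OF f, of k i] by (auto simp: S_inner_weight mult_ac)
    qed (use K in auto)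
    finally show ?thesis .
  qed
  have "(ip_norm ip (e j))\<^sup>2 \<le> sum ?g {1..j} * (\<Sum>l=1..j. ?n l)"
    using weighted_sum_norm_sq_le[of "{1..j}" ?g ?d] g d j
      telescope_increment[OF N T, of j e] by auto
  also have "\<dots> \<le> sum ?g {1..N} * (\<Sum>l=1..N. ?n l)"
    using g j by (intro mult_mono sum_mono2 sum_nonneg mult_nonneg_nonneg) auto
  also have "\<dots> = (1 + T) * (\<Sum>l=1..N. ?n l)"
    by (simp only: sum_weight[OF N])
  also have "\<dots> \<le> 2 * max T 1 * (\<Sum>l=1..N. ?n l)"
    using g by (intro mult_right_mono sum_nonneg mult_nonneg_nonneg) auto
  finally show ?thesis by (simp only: sum_n)
qed


lemma (in rc_vector_space) K1_in_subspace:
  assumes "2 \<le> N" "subspace Z" "\<forall>j\<in>{1..N}. u j \<in> Z"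
  shows "K1 scale T N u g \<in> Z"
  unfolding K1_def diff_quot_def
  using assms by (intro subspace_add subspace_sum subspace_scale subspace_diff) auto

text \<open>
  \<open>K1\<close> is linear in the data, and thus commutes with the linear map \<open>x \<mapsto> x - P x\<close>.  As \<open>P\<close> is
  linear only on \<open>Z\<close>, every intermediate vector has to be kept in \<open>Z\<close>.
\<close>

lemma (in rc_vector_space) K1_defect:
  assumes N: "2 \<le> N" and Z: "subspace Z" and u: "\<forall>j\<in>{1..N}. u j \<in> Z"
    and add: "\<And>x y. x \<in> Z \<Longrightarrow> y \<in> Z \<Longrightarrow> P (x + y) = P x + P y"
    and hom: "\<And>c x. x \<in> Z \<Longrightarrow> P (scale c x) = scale c (P x)"
  shows "K1 scale T N (\<lambda>j. u j - P (u j)) g = K1 scale T N u g - P (K1 scale T N u g)"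
proof -
  let ?W = "\<lambda>x. x - P x"
  have W_add: "?W (x + y) = ?W x + ?W y" if "x \<in> Z" "y \<in> Z" for x y
    using add[OF that] by simp
  have W_scale: "?W (scale c x) = scale c (?W x)" if "x \<in> Z" for c x
    using hom[OF that] by (simp add: scale_right_diff_distrib)
  have W_diff: "?W (x - y) = ?W x - ?W y" if "x \<in> Z" "y \<in> Z" for x y
  proof -
    have "?W (x + scale (- 1) y) = ?W x + scale (- 1) (?W y)"
      using W_add W_scale subspace_scale[OF Z] that by (simp only:)
    then show ?thesis by simp
  qed
  have W_sum: "?W (sum h A) = (\<Sum>i\<in>A. ?W (h i))" if "\<And>i. i \<in> A \<Longrightarrow> h i \<in> Z" for h and A :: "nat set"
    using that
  proof (induction A rule: infinite_finite_induct)
    case (insert i A)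
    then show ?case using W_add[of "h i" "sum h A"] subspace_sum[OF Z, of A h] by simp
  qed (use W_scale[OF subspace_0[OF Z], of 0] in simp_all)
  have inc: "increment scale T N u l \<in> Z \<and>
      increment scale T N (\<lambda>j. ?W (u j)) l = ?W (increment scale T N u l)" if l: "l \<in> {1..N}" for l
  proof (cases "l = 1")
    case True
    then show ?thesis using u N by (simp add: increment_def)
  next
    case False
    then obtain k where k: "l = Suc k" "k \<noteq> 0" "u k \<in> Z" "u (Suc k) \<in> Z"
      using u l by (cases l) auto
    then have "u (Suc k) - u k \<in> Z" by (intro subspace_diff[OF Z])
    then show ?thesis
      using k W_diff[of "u (Suc k)" "u k"] W_scale[of "u (Suc k) - u k"] subspace_scale[OF Z]
      by (simp add: increment_def diff_quot_def)
  qed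
  have "?W (K1 scale T N u g)
      = (\<Sum>l=1..N. ?W (scale (of_real (weight T N l) * g l) (increment scale T N u l)))"
    unfolding K1_increment[OF N] using inc subspace_scale[OF Z] by (intro W_sum) blast
  also have "\<dots> = (\<Sum>l=1..N. scale (of_real (weight T N l) * g l) (increment scale T N (\<lambda>j. ?W (u j)) l))"
    using inc W_scale by (intro sum.cong refl) simp
  finally show ?thesis unfolding K1_increment[OF N] by simp
qed

section \<open>POD data\<close>

lemma downward_closed_eq_card:
  assumes "A \<subseteq> {1..N}" "\<And>i j. j \<in> A \<Longrightarrow> 1 \<le> i \<Longrightarrow> i \<le> j \<Longrightarrow> i \<in> A"
  shows "A = {1..card A}"
proof (cases "A = {}")
  case False
  have fin: "finite A" using assms(1) finite_subset by blast
  have "A = {1..Max A}"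
    using assms Max_ge[OF fin] Max_in[OF fin False] by auto
  then show ?thesis by (metis card_atLeastAtMost diff_Suc_1 Suc_eq_plus1)
qed simp

lemma is_pod_DQ1D:
  assumes "is_pod_DQ1 scale T N X ip u q lam f \<phi>"
  shows "orthonormal_on (S_inner T N) {1..N} f"
    and "orthonormal_on ip {i. 1 \<le> i \<and> enat i \<le> q} \<phi>"
    and "1 \<le> i \<Longrightarrow> enat i \<le> q \<Longrightarrow> \<phi> i \<in> X"
    and "i \<in> {1..N} \<Longrightarrow> 0 \<le> lam i"
    and "i \<in> {1..N} \<Longrightarrow> j \<in> {1..N} \<Longrightarrow> i \<le> j \<Longrightarrow> sqrt (lam j) \<le> sqrt (lam i)"
    and "i \<in> {1..N} \<Longrightarrow> enat i \<le> q \<Longrightarrow>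
      K1 scale T N u (f i) = scale (of_real (sqrt (lam i))) (\<phi> i)"
    and "i \<in> {1..N} \<Longrightarrow> \<not> enat i \<le> q \<Longrightarrow> sqrt (lam i) = 0 \<and> K1 scale T N u (f i) = 0"
proof -
  note pod = assms[unfolded is_pod_DQ1_def is_svd_def]
  show "orthonormal_on (S_inner T N) {1..N} f"
    using pod by (elim conjE)
  show "orthonormal_on ip {i. 1 \<le> i \<and> enat i \<le> q} \<phi>"
    using pod by (elim conjE)
  have "\<forall>i. 1 \<le> i \<and> enat i \<le> q \<longrightarrow> \<phi> i \<in> X"
    using pod by (elim conjE)
  then show "1 \<le> i \<Longrightarrow> enat i \<le> q \<Longrightarrow> \<phi> i \<in> X" by blast
  have "\<forall>i\<in>{1..N}. 0 \<le> lam i"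
    using pod by (elim conjE)
  then show "i \<in> {1..N} \<Longrightarrow> 0 \<le> lam i" by blast
  have "\<forall>i\<in>{1..N}. \<forall>j\<in>{1..N}. i \<le> j \<longrightarrow> sqrt (lam j) \<le> sqrt (lam i)"
    using pod by (elim conjE)
  then show "i \<in> {1..N} \<Longrightarrow> j \<in> {1..N} \<Longrightarrow> i \<le> j \<Longrightarrow> sqrt (lam j) \<le> sqrt (lam i)" by blast
  have "\<forall>i\<in>{1..N}. enat i \<le> q \<longrightarrow> K1 scale T N u (f i) = scale (of_real (sqrt (lam i))) (\<phi> i)"
    using pod by (elim conjE)
  then show "i \<in> {1..N} \<Longrightarrow> enat i \<le> q \<Longrightarrow>
      K1 scale T N u (f i) = scale (of_real (sqrt (lam i))) (\<phi> i)" by blast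
  have "\<forall>i\<in>{1..N}. \<not> enat i \<le> q \<longrightarrow> sqrt (lam i) = 0 \<and> K1 scale T N u (f i) = 0"
    using pod by (elim conjE)
  then show "i \<in> {1..N} \<Longrightarrow> \<not> enat i \<le> q \<Longrightarrow> sqrt (lam i) = 0 \<and> K1 scale T N u (f i) = 0"
    by blast
qed

text \<open>
  Since the eigenvalues decrease, the positive ones are the first \<open>s\<close>; this turns the cardinality
  that defines \<open>s\<close> into an upper summation limit.
\<close>

lemma positive_pod_eigenvalues:
  assumes pod: "is_pod_DQ1 scale T N X ip u q lam f \<phi>"
    and s: "s = card {i \<in> {1..N}. 0 < lam i}"
  shows "s \<le> N" and "{i \<in> {1..N}. 0 < lam i} = {1..s}"
proof -
  show eq: "{i \<in> {1..N}. 0 < lam i} = {1..s}"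
    unfolding s
  proof (rule downward_closed_eq_card[of _ N])
    fix i j assume ij: "j \<in> {i \<in> {1..N}. 0 < lam i}" "1 \<le> i" "i \<le> j"
    then have "i \<in> {1..N}" by auto
    then show "i \<in> {i \<in> {1..N}. 0 < lam i}"
      using ij is_pod_DQ1D(5)[OF pod, of i j] by simp
  qed auto
  have "{1..s} \<subseteq> {1..N}" unfolding eq[symmetric] by blast
  then show "s \<le> N" by (cases "s = 0") auto
qed

text \<open>
  The case distinction on the number \<open>q\<close> of left singular vectors disappears: a singular value without
  a left singular vector is zero, hence its index exceeds \<open>s\<close>.
\<close>

lemma (in rc_vector_space) K1_singular_vector:
  assumes pod: "is_pod_DQ1 scale T N X ip u q lam f \<phi>"
    and s: "s = card {i \<in> {1..N}. 0 < lam i}" and i: "i \<in> {1..N}"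
  shows "K1 scale T N u (f i) = (if i \<le> s then scale (of_real (sqrt (lam i))) (\<phi> i) else 0)"
    and "i \<le> s \<Longrightarrow> enat i \<le> q"
proof -
  have "i \<in> {i \<in> {1..N}. 0 < lam i} \<longleftrightarrow> i \<in> {1..s}"
    by (simp only: positive_pod_eigenvalues(2)[OF pod s])
  then have iff: "i \<le> s \<longleftrightarrow> 0 < lam i"
    using i by simp
  show q: "enat i \<le> q" if "i \<le> s"
  proof (rule ccontr)
    assume "\<not> enat i \<le> q"
    then have "sqrt (lam i) = 0" using is_pod_DQ1D(7)[OF pod i] by blast
    then show False using that iff by simp
  qed
  show "K1 scale T N u (f i) = (if i \<le> s then scale (of_real (sqrt (lam i))) (\<phi> i) else 0)"
  proof (cases "i \<le> s")
    case True
    then show ?thesis using is_pod_DQ1D(6)[OF pod i q[OF True]] by simp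
  next
    case False
    then have "lam i = 0" using is_pod_DQ1D(4)[OF pod i] iff by simp
    with False show ?thesis
      using is_pod_DQ1D(6,7)[OF pod i] by (cases "enat i \<le> q") simp_all
  qed
qed

text \<open>For \<open>i \<le> s\<close> the mode is \<open>\<lambda>\<^sub>i\<^sup>-\<^sup>1\<^sup>/\<^sup>2 K\<^sub>1 f\<^sub>i\<close>, a linear combination of the data.\<close>

lemma (in rc_vector_space) pod_mode_in_subspace:
  assumes N: "2 \<le> N" and pod: "is_pod_DQ1 scale T N X ip u q lam f \<phi>"
    and s: "s = card {i \<in> {1..N}. 0 < lam i}"
    and Z: "subspace Z" "\<forall>j\<in>{1..N}. u j \<in> Z" and i: "i \<in> {1..s}"
  shows "\<phi> i \<in> Z"
proof -
  have "i \<in> {i \<in> {1..N}. 0 < lam i}"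
    unfolding positive_pod_eigenvalues(2)[OF pod s] by (rule i)
  then have iN: "i \<in> {1..N}" "0 < lam i" by simp_all
  have "scale (of_real (1 / sqrt (lam i))) (K1 scale T N u (f i)) \<in> Z"
    by (intro subspace_scale K1_in_subspace N Z)
  then show ?thesis
    using K1_singular_vector(1)[OF pod s iN(1)] i iN(2) by (simp flip: of_real_mult)
qed

lemma projection_ontoD:
  assumes "projection_onto scale D ip Z P"
  shows "x \<in> D \<Longrightarrow> P x \<in> D"
    and "x \<in> D \<Longrightarrow> y \<in> D \<Longrightarrow> P (x + y) = P x + P y"
    and "x \<in> D \<Longrightarrow> P (scale c x) = scale c (P x)"
    and "z \<in> Z \<Longrightarrow> P z = z"
    and "x \<in> D \<Longrightarrow> P x \<in> Z"
  using assms unfolding projection_onto_def bounded_linear_on_def by auto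

text \<open>
  Three spaces occur: the modes are orthonormal in \<open>Z\<close>, the projection acts on \<open>D\<close>, and the error is
  measured in the norm of \<open>X\<close>.  For the orthogonal projection of the first space measured in the
  norm of another one, \<open>D = Z\<close>; for a projection of the second space, \<open>D = X\<close>.
\<close>

lemma (in hilbert_space) pod_projection_error:
  assumes N: "2 \<le> N" and T: "0 < T"
    and pod: "is_pod_DQ1 scale T N Z ipZ u q lam f \<phi>"
    and s: "s = card {i \<in> {1..N}. 0 < lam i}"
    and D: "subspace D" "\<forall>j\<in>{1..N}. u j \<in> D"
    and P: "projection_onto scale D ipD (span (\<phi> ` {1..r})) P"
    and mem: "\<And>i. i \<in> {r+1..s} \<Longrightarrow> \<phi> i - P (\<phi> i) \<in> X"
    and j: "j \<in> {1..N}"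
  shows "(ip_norm ip (u j - P (u j)))\<^sup>2
    \<le> 2 * max T 1 * (\<Sum>i=r+1..s. lam i * (ip_norm ip (\<phi> i - P (\<phi> i)))\<^sup>2)"
proof -
  let ?e = "\<lambda>j. u j - P (u j)"
  let ?E = "\<lambda>i. \<phi> i - P (\<phi> i)"
  note pos = positive_pod_eigenvalues[OF pod s]
  note add = projection_ontoD(2)[OF P] and hom = projection_ontoD(3)[OF P]
  have fixed: "P (\<phi> i) = \<phi> i" if "i \<in> {1..r}" for i
    using that by (intro projection_ontoD(4)[OF P] span_base) blast
  have P0: "P 0 = 0"
    using hom[OF subspace_0[OF D(1)], of 0] by simp
  have defect: "K1 scale T N ?e (f i) = K1 scale T N u (f i) - P (K1 scale T N u (f i))" for i
    by (rule K1_defect[OF N D]) (simp_all add: add hom)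
  have K: "K1 scale T N ?e (f i) = (if i \<in> {r+1..s} then scale (of_real (sqrt (lam i))) (?E i) else 0)"
    if i: "i \<in> {1..N}" for i
  proof (cases "i \<le> s")
    case True
    then have "\<phi> i \<in> D"
      using i by (intro pod_mode_in_subspace[OF N pod s D]) auto
    then show ?thesis
      unfolding defect K1_singular_vector(1)[OF pod s i]
      using True i fixed[of i] by (auto simp: hom scale_right_diff_distrib)
  next
    case False
    then show ?thesis
      unfolding defect K1_singular_vector(1)[OF pod s i]
      by (simp add: P0)
  qed
  have "K1 scale T N ?e (f i) \<in> X" if "i \<in> {1..N}" for i
    using K[OF that] mem subspace_scale[OF subspace_carrier] subspace_0[OF subspace_carrier] by simp
  then have "(ip_norm ip (?e j))\<^sup>2
      \<le> 2 * max T 1 * (\<Sum>i=1..N. (ip_norm ip (K1 scale T N ?e (f i)))\<^sup>2)"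
    using pointwise_norm_sq_le[OF N T is_pod_DQ1D(1)[OF pod] _ j] by blast
  also have "(\<Sum>i=1..N. (ip_norm ip (K1 scale T N ?e (f i)))\<^sup>2)
      = (\<Sum>i=r+1..s. (ip_norm ip (K1 scale T N ?e (f i)))\<^sup>2)"
    using pos(1) K by (intro sum.mono_neutral_right) auto
  also have "\<dots> = (\<Sum>i=r+1..s. lam i * (ip_norm ip (?E i))\<^sup>2)"
  proof (intro sum.cong refl)
    fix i assume i: "i \<in> {r+1..s}"
    then have "i \<in> {i \<in> {1..N}. 0 < lam i}" unfolding pos(2) by simp
    then have "i \<in> {1..N}" "0 < lam i" by simp_all
    then show "(ip_norm ip (K1 scale T N ?e (f i)))\<^sup>2 = lam i * (ip_norm ip (?E i))\<^sup>2"
      using K[of i] i mem[OF i] by (simp add: ip_norm_scale_sq)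
  qed
  finally show ?thesis .
qed

lemma (in hilbert_space) orthogonal_to_span:
  assumes "y \<in> X" "A \<subseteq> X" "\<And>x. x \<in> A \<Longrightarrow> ip y x = 0" "z \<in> span A"
  shows "ip y z = 0"
proof -
  have "subspace {x \<in> X. ip y x = 0}"
    using assms(1) subspace_0[OF subspace_carrier] subspace_add[OF subspace_carrier]
      subspace_scale[OF subspace_carrier]
    by (intro subspaceI) (simp_all add: ip_zero_right ip_add_right ip_scale_right)
  then have "span A \<subseteq> {x \<in> X. ip y x = 0}"
    using assms(2,3) by (intro span_minimal) auto
  then show ?thesis using assms(4) by blast
qed

text \<open>Here \<open>P y\<close> is orthogonal to itself: \<open>y - P y\<close> and \<open>y\<close> are both orthogonal to the span.\<close>

lemma (in hilbert_space) orthogonal_projection_eq_zero: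
  assumes P: "orthogonal_projection_onto scale X ip (span A) P"
    and "y \<in> X" "A \<subseteq> X" "\<And>x. x \<in> A \<Longrightarrow> ip y x = 0"
  shows "P y = 0"
proof -
  have Py: "P y \<in> span A" "P y \<in> X"
    using P assms(2) projection_ontoD(1,5)[of scale X ip "span A" P y]
    by (simp_all add: orthogonal_projection_onto_def)
  have orth: "ip (y - P y) (P y) = 0"
    using P assms(2) Py(1) unfolding orthogonal_projection_onto_def by blast
  have "y - P y \<in> X" using assms(2) Py subspace_diff[OF subspace_carrier] by blast
  then have "ip (y - P y + P y) (P y) = ip (P y) (P y)"
    using Py orth ip_add_left[of "y - P y" "P y" "P y"] by simp
  then have "ip (P y) (P y) = 0"
    using orthogonal_to_span[OF assms(2-4) Py(1)] by simp
  then show ?thesis using ip_pos[OF Py(2)] by (metis less_irrefl re_zero)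
qed

theorem theorem3p4:
  fixes scale :: "'k::rc_scalar \<Rightarrow> 'v::ab_group_add \<Rightarrow> 'v"
    and X :: "'v set" and ipX :: "'v \<Rightarrow> 'v \<Rightarrow> 'k"
    and N r s :: nat and T C :: real and q :: enat
    and u \<phi> :: "nat \<Rightarrow> 'v" and lam :: "nat \<Rightarrow> real" and f :: "nat \<Rightarrow> nat \<Rightarrow> 'k"
    and Xr :: "'v set" and Pi :: "'v \<Rightarrow> 'v"
  assumes "hilbert_space scale X ipX"
    and "2 \<le> N" and "0 < T"
    and "\<forall>j\<in>{1..N}. u j \<in> X"
    and "is_pod_DQ1 scale T N X ipX u q lam f \<phi>"
    and "s = card {i \<in> {1..N}. 0 < lam i}"
    and "1 \<le> r" and "enat r \<le> q"
    and "Xr = module.span scale (\<phi> ` {1..r})"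
    and "orthogonal_projection_onto scale X ipX Xr Pi"
    and "C = 2 * max T 1"
  shows "(MAX j\<in>{1..N}. (ip_norm ipX (u j - Pi (u j)))\<^sup>2) \<le> C * (\<Sum>i=r+1..s. lam i)
    \<and> (\<forall>Y ipY. hilbert_space scale Y ipY \<and> (\<forall>j\<in>{1..N}. u j \<in> Y) \<longrightarrow>
         (MAX j\<in>{1..N}. (ip_norm ipY (u j - Pi (u j)))\<^sup>2)
           \<le> C * (\<Sum>i=r+1..s. lam i * (ip_norm ipY (\<phi> i))\<^sup>2)
         \<and> (\<forall>p. projection_onto scale Y ipY Xr p \<longrightarrow>
              (MAX j\<in>{1..N}. (ip_norm ipY (u j - p (u j)))\<^sup>2)
                \<le> C * (\<Sum>i=r+1..s. lam i * (ip_norm ipY (\<phi> i - p (\<phi> i)))\<^sup>2)))"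
proof -
  interpret X: hilbert_space scale X ipX by fact
  note pod = \<open>is_pod_DQ1 scale T N X ipX u q lam f \<phi>\<close>
  note s = \<open>s = card {i \<in> {1..N}. 0 < lam i}\<close>
  note N = \<open>2 \<le> N\<close> and T = \<open>0 < T\<close> and C = \<open>C = 2 * max T 1\<close>
    and uX = \<open>\<forall>j\<in>{1..N}. u j \<in> X\<close> and Xr = \<open>Xr = X.span (\<phi> ` {1..r})\<close>
  note Pi = \<open>orthogonal_projection_onto scale X ipX Xr Pi\<close>[unfolded Xr]
  have Pi_proj: "projection_onto scale X ipX (X.span (\<phi> ` {1..r})) Pi"
    using Pi by (simp only: orthogonal_projection_onto_def)
  have Max_le: "(MAX j\<in>{1..N}. g j) \<le> B" if "\<And>j. j \<in> {1..N} \<Longrightarrow> g j \<le> B"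
    for g :: "nat \<Rightarrow> real" and B
    using that N by (intro Max.boundedI) auto

  have mode_q: "1 \<le> i" "enat i \<le> q" if "i \<in> {1..r} \<union> {1..s}" for i
  proof -
    show "1 \<le> i" using that by auto
    have "enat i \<le> q" if "i \<le> r"
    proof -
      have "enat i \<le> enat r" using that by simp
      then show ?thesis using \<open>enat r \<le> q\<close> by (rule order_trans)
    qed
    moreover have "enat i \<le> q" if "i \<in> {1..s}"
      using X.K1_singular_vector(2)[OF pod s, of i] positive_pod_eigenvalues(1)[OF pod s] that
      by simp
    ultimately show "enat i \<le> q" using that by auto
  qed
  have modeX: "\<phi> i \<in> X" if "i \<in> {1..r} \<union> {1..s}" for i
    using is_pod_DQ1D(3)[OF pod] mode_q[OF that] by blast
  have mode_orth: "ipX (\<phi> i) (\<phi> k) = (if i = k then 1 else 0)"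
    if "i \<in> {1..r} \<union> {1..s}" "k \<in> {1..r} \<union> {1..s}" for i k
    using orthonormal_onD[OF is_pod_DQ1D(2)[OF pod], of i k] mode_q[OF that(1)] mode_q[OF that(2)]
    by simp
  have Pi_tail: "Pi (\<phi> i) = 0" if i: "i \<in> {r+1..s}" for i
  proof (rule X.orthogonal_projection_eq_zero[OF Pi])
    show "\<phi> i \<in> X" using modeX[of i] i by simp
    show "\<phi> ` {1..r} \<subseteq> X" using modeX by blast
    show "ipX (\<phi> i) x = 0" if "x \<in> \<phi> ` {1..r}" for x
      using that mode_orth[of i] i by auto
  qed

  have Pi_error: "(MAX j\<in>{1..N}. (ip_norm ip (u j - Pi (u j)))\<^sup>2)
      \<le> C * (\<Sum>i=r+1..s. lam i * (ip_norm ip (\<phi> i))\<^sup>2)"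
    if Y: "hilbert_space scale Y ip" and uY: "\<forall>j\<in>{1..N}. u j \<in> Y" for Y ip
  proof (rule Max_le)
    fix j assume j: "j \<in> {1..N}"
    interpret Y: hilbert_space scale Y ip by (rule Y)
    have "\<phi> i - Pi (\<phi> i) \<in> Y" if i: "i \<in> {r+1..s}" for i
      using X.pod_mode_in_subspace[OF N pod s Y.subspace_carrier uY, of i] Pi_tail[OF i] i by simp
    then show "(ip_norm ip (u j - Pi (u j)))\<^sup>2
        \<le> C * (\<Sum>i=r+1..s. lam i * (ip_norm ip (\<phi> i))\<^sup>2)"
      using Y.pod_projection_error[OF N T pod s X.subspace_carrier uX Pi_proj _ j]
      by (simp add: C Pi_tail)
  qed
  have p_error: "(MAX j\<in>{1..N}. (ip_norm ip (u j - p (u j)))\<^sup>2)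
      \<le> C * (\<Sum>i=r+1..s. lam i * (ip_norm ip (\<phi> i - p (\<phi> i)))\<^sup>2)"
    if Y: "hilbert_space scale Y ip" and uY: "\<forall>j\<in>{1..N}. u j \<in> Y"
      and p: "projection_onto scale Y ip Xr p" for Y ip p
  proof (rule Max_le)
    fix j assume j: "j \<in> {1..N}"
    interpret Y: hilbert_space scale Y ip by (rule Y)
    have "\<phi> i - p (\<phi> i) \<in> Y" if i: "i \<in> {r+1..s}" for i
    proof -
      have "\<phi> i \<in> Y"
        using X.pod_mode_in_subspace[OF N pod s Y.subspace_carrier uY, of i] i by simp
      then show ?thesis
        using projection_ontoD(1)[OF p] by (intro X.subspace_diff[OF Y.subspace_carrier]) auto
    qed
    then show "(ip_norm ip (u j - p (u j)))\<^sup>2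
        \<le> C * (\<Sum>i=r+1..s. lam i * (ip_norm ip (\<phi> i - p (\<phi> i)))\<^sup>2)"
      unfolding C by (rule Y.pod_projection_error[OF N T pod s Y.subspace_carrier uY p[unfolded Xr] _ j])
  qed
  have "ip_norm ipX (\<phi> i) = 1" if "i \<in> {r+1..s}" for i
    using mode_orth[of i i] that re_of_real[of 1, where 'k='k] by (simp add: ip_norm_def)
  then have "(MAX j\<in>{1..N}. (ip_norm ipX (u j - Pi (u j)))\<^sup>2) \<le> C * (\<Sum>i=r+1..s. lam i)"
    using Pi_error[OF X.hilbert_space_axioms uX] by simp
  then show ?thesis using Pi_error p_error by blast
qed

end
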